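(* Let $K$ be a field. If $\mathcal{D}$ is a transitive weighted oriented graph with vertex set $\{x_1,\ldots,x_n\}$ and $I=I(\mathcal{D})\subset R=K[x_1,\ldots,x_n]$ is its edge ideal, then Alexander duality holds for $I$, that is, $I^*=I^\vee$.
   Context: An oriented graph $\mathcal{D}$ is a finite simple graph together with an orientation of each of its edges; $V(\mathcal{D})$ is its vertex set and $E(\mathcal{D})$ is its set of arrows $(x_i,x_j)$ (from $x_i$ to $x_j$). It is weighted if it is endowed with a function $d\colon V(\mathcal{D})\to\mathbb{N}_+=\{1,2,\ldots\}$; write $d_i=d(x_i)$. Standing convention: if a vertex $x_i$ is a source (it has only arrows leaving it), then $d_i=1$. The edge ideal of $\mathcal{D}$ is $I(\mathcal{D})=(x_ix_j^{d_j}\mid (x_i,x_j)\in E(\mathcal{D}))\subset R$. $\mathcal{D}$ is transitive if for any two edges $(x_i,x_j),(x_j,x_k)\in E(\mathcal{D})$ with $i,j,k$ distinct, one has $(x_i,x_k)\in E(\mathcal{D})$. For a monomial ideal $I\subset R$, $G(I)$ denotes its unique minimal generating set of monomials. An ideal is irreducible if it is not an intersection of two ideals properly containing it; the irreducible monomial ideals of $R$ are, up to permutation of the variables, the ideals $(x_1^{a_1},\ldots,x_r^{a_r})$ with all $a_i\geq 1$. Every monomial ideal has a unique irredundant decomposition $I=I_1\cap\cdots\cap I_m$ into irreducible monomial ideals; $I_1,\ldots,I_m$ are the irreducible components of $I$. The Alexander dual of $I$ is $$I^\vee=\Bigl(\prod_{f\in G(I_1)}f,\ \ldots,\ \prod_{f\in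 G(I_m)}f\Bigr),$$ and the dual of $I$ is $$I^*=\bigcap_{x^a\in G(I)}(\{x_i^{a_i}\mid a_i\geq 1\}),$$ where $x^a=x_1^{a_1}\cdots x_n^{a_n}$ for $a=(a_1,\ldots,a_n)$. *)

theory Defs
  imports Complex_Main "HOL-Library.Poly_Mapping"
begin

text \<open>
  The polynomial ring over \<open>'k\<close> in the variables \<open>'v\<close>: finitely supported functions from exponent
  vectors to coefficients, with the convolution product of \<open>Poly_Mapping\<close>.
\<close>

type_synonym ('v, 'k) mpoly = "('v \<Rightarrow>\<^sub>0 nat) \<Rightarrow>\<^sub>0 'k"

definition monom :: "('v \<Rightarrow>\<^sub>0 nat) \<Rightarrow> ('v, 'k::comm_ring_1) mpoly"
  where "monom a = Poly_Mapping.single a 1"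

definition Var :: "'v \<Rightarrow> ('v, 'k::comm_ring_1) mpoly"
  where "Var v = monom (Poly_Mapping.single v 1)"

text \<open>Ideals of a commutative ring are its submodules when it is viewed as a module over itself.\<close>

abbreviation is_ideal :: "'a::comm_ring_1 set \<Rightarrow> bool"
  where "is_ideal \<equiv> module.subspace (*)"

abbreviation ideal_gen :: "'a::comm_ring_1 set \<Rightarrow> 'a set"
  where "ideal_gen \<equiv> module.span (*)"

definition monomial_ideal :: "('v, 'k::comm_ring_1) mpoly set \<Rightarrow> bool"
  where "monomial_ideal I \<longleftrightarrow> (\<exists>G \<subseteq> range monom. I = ideal_gen G)"

text \<open>
  \<open>min_gens I\<close> and \<open>irreducible_components I\<close> below are only meaningful for monomial ideals,
  for which the described objects exist and are unique.
\<close>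

definition min_gens :: "('v, 'k::comm_ring_1) mpoly set \<Rightarrow> ('v, 'k) mpoly set"
  where "min_gens I =
    (THE G. G \<subseteq> range monom \<and> ideal_gen G = I \<and> (\<forall>H. H \<subset> G \<longrightarrow> ideal_gen H \<noteq> I))"

text \<open>
  Irreducible ideals are proper, so that the irreducible monomial ideals are exactly those
  generated by positive powers of distinct variables (the zero ideal included).
\<close>

definition irreducible_ideal :: "'a::comm_ring_1 set \<Rightarrow> bool"
  where "irreducible_ideal J \<longleftrightarrow> is_ideal J \<and> J \<noteq> UNIV \<and>
    \<not> (\<exists>A B. is_ideal A \<and> is_ideal B \<and> J \<subset> A \<and> J \<subset> B \<and> J = A \<inter> B)"

definition irredundant_irreducible_decomposition ::
    "('v, 'k::comm_ring_1) mpoly set set \<Rightarrow> ('v, 'k) mpoly set \<Rightarrow> bool"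
  where "irredundant_irreducible_decomposition C I \<longleftrightarrow>
    finite C \<and> (\<forall>J\<in>C. monomial_ideal J \<and> irreducible_ideal J) \<and>
    \<Inter>C = I \<and> (\<forall>C'. C' \<subset> C \<longrightarrow> \<Inter>C' \<noteq> I)"

definition irreducible_components ::
    "('v, 'k::comm_ring_1) mpoly set \<Rightarrow> ('v, 'k) mpoly set set"
  where "irreducible_components I = (THE C. irredundant_irreducible_decomposition C I)"

definition alexander_dual :: "('v, 'k::comm_ring_1) mpoly set \<Rightarrow> ('v, 'k) mpoly set"
  where "alexander_dual I = ideal_gen {\<Prod>f\<in>min_gens J. f | J. J \<in> irreducible_components I}"

definition dual_ideal :: "('v, 'k::comm_ring_1) mpoly set \<Rightarrow> ('v, 'k) mpoly set"
  where "dual_ideal I = (\<Inter>a \<in> {a. monom a \<in> min_gens I}.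
    ideal_gen {Var i ^ Poly_Mapping.lookup a i | i. Poly_Mapping.lookup a i \<ge> 1})"

text \<open>
  An oriented graph on the vertex set \<open>UNIV :: 'v set\<close> is given by its set of arrows; asymmetry
  says that there are no loops and that each edge carries only one of its two orientations.
\<close>

definition is_source :: "('v \<times> 'v) set \<Rightarrow> 'v \<Rightarrow> bool"
  where "is_source E v \<longleftrightarrow> (\<exists>w. (v, w) \<in> E) \<and> (\<forall>w. (w, v) \<notin> E)"

definition weighted_oriented_graph :: "('v::finite \<times> 'v) set \<Rightarrow> ('v \<Rightarrow> nat) \<Rightarrow> bool"
  where "weighted_oriented_graph E d \<longleftrightarrow>
    asym E \<and> (\<forall>v. d v \<ge> 1) \<and> (\<forall>v. is_source E v \<longrightarrow> d v = 1)"

definition transitive_graph :: "('v \<times> 'v) set \<Rightarrow> bool"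
  where "transitive_graph E \<longleftrightarrow> (\<forall>i j k. i \<noteq> j \<and> j \<noteq> k \<and> i \<noteq> k \<and>
    (i, j) \<in> E \<and> (j, k) \<in> E \<longrightarrow> (i, k) \<in> E)"

definition edge_ideal :: "('v \<times> 'v) set \<Rightarrow> ('v \<Rightarrow> nat) \<Rightarrow> ('v, 'k::comm_ring_1) mpoly set"
  where "edge_ideal E d = ideal_gen {Var i * Var j ^ d j | i j. (i, j) \<in> E}"

end

theory Submission
  imports Defs "HOL-Library.FuncSet"
begin

text \<open>
  A transitive orientation is a strict partial order on the vertices. Both ideals are monomial, so
  the claim is about exponent vectors, and the partial order decides it.

  Membership in \<open>I\<^sup>*\<close> is a covering condition. The minimal generators of \<open>I\<close> are the given
  ones, \<open>x\<^sub>i\<close> times the \<open>d j\<close>-th power of \<open>x\<^sub>j\<close> (\<open>min_gens_edge_ideal\<close>), so a monomial with exponent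
  \<open>u\<close> lies in \<open>I\<^sup>*\<close> iff \<open>u i \<ge> 1\<close> or \<open>u j \<ge> d j\<close> for every arrow \<open>(i, j)\<close>
  (\<open>mem_dual_edge_ideal_iff\<close>).

  For the Alexander dual, the irreducible components must be identified. Ideals generated by pure
  powers of variables are irreducible among all ideals (\<open>irreducible_pure_power_ideal\<close>, by a socle
  argument), and they are the only irreducible monomial ideals
  (\<open>irreducible_monomial_ideal_is_pure_power_ideal\<close>). If \<open>I\<close> is written as a finite intersection of
  such ideals, its components are the inclusion-minimal ones among them
  (\<open>irreducible_components_Inter\<close>). The edge ideal is the intersection of the pure power ideals
  containing it whose generators are variables or \<open>d v\<close>-th powers of variables \<open>v\<close>
  (\<open>edge_ideal_eq_Inter\<close>). The product
  of the minimal generators of the ideal with exponents \<open>c\<close> is the monomial with exponent \<open>c\<close>, so the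
  Alexander dual is generated by the monomials of those \<open>c\<close> whose ideals are minimal.

  It remains to compare covers with these \<open>c\<close>. Every such \<open>c\<close> is a cover
  (\<open>maximal_edge_containing_is_cover\<close>), which gives one inclusion. Conversely, below a given cover take
  a minimal one, \<open>u\<close>; any component inside the ideal generated by the variables in the support of \<open>u\<close>
  has exponents bounded by \<open>u\<close> (\<open>minimal_cover_above_refinement\<close>). Both steps
  pass from two consecutive arrows \<open>(i, j)\<close>, \<open>(j, k)\<close> with \<open>c k = 0\<close> to the arrow \<open>(i, k)\<close>: the edge
  ideal is contained in the ideal of \<open>c\<close>, so that arrow forces \<open>c i = 1\<close>.
\<close>

abbreviation lookup :: "('a \<Rightarrow>\<^sub>0 'b::zero) \<Rightarrow> 'a \<Rightarrow> 'b"
  where "lookup \<equiv> Poly_Mapping.lookup"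

abbreviation keys :: "('a \<Rightarrow>\<^sub>0 'b::zero) \<Rightarrow> 'a set"
  where "keys \<equiv> Poly_Mapping.keys"

abbreviation single :: "'a \<Rightarrow> 'b \<Rightarrow> 'a \<Rightarrow>\<^sub>0 'b::zero"
  where "single \<equiv> Poly_Mapping.single"

interpretation ideals: module "(*) :: 'a::comm_ring_1 \<Rightarrow> 'a \<Rightarrow> 'a"
  by unfold_locales (auto simp: algebra_simps)

section \<open>Monomials and monomial ideals\<close>

text \<open>
  Divisibility of monomials, on exponent vectors. The order that is already defined on
  \<open>'v \<Rightarrow>\<^sub>0 nat\<close> is lexicographic and needs ordered variables.
\<close>
definition exp_le :: "('v \<Rightarrow>\<^sub>0 nat) \<Rightarrow> ('v \<Rightarrow>\<^sub>0 nat) \<Rightarrow> bool"  (infix \<open>\<preceq>\<close> 50)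
  where "a \<preceq> b \<longleftrightarrow> (\<forall>v. lookup a v \<le> lookup b v)"

lemma exp_le_refl [simp]: "a \<preceq> a"
  by (simp add: exp_le_def)

lemma exp_le_trans: "a \<preceq> b \<Longrightarrow> b \<preceq> c \<Longrightarrow> a \<preceq> c"
  unfolding exp_le_def using le_trans by blast

lemma exp_le_antisym: "a \<preceq> b \<Longrightarrow> b \<preceq> a \<Longrightarrow> a = b"
  by (intro poly_mapping_eqI) (simp add: exp_le_def le_antisym)

lemma exp_le_add: "a \<preceq> c + a"
  by (simp add: exp_le_def lookup_add)

lemma exp_le_diff_add: "a \<preceq> b \<Longrightarrow> b - a + a = b"
  by (intro poly_mapping_eqI) (simp add: exp_le_def lookup_add lookup_minus)

lemma exp_le_single: "single i k \<preceq> t \<longleftrightarrow> k \<le> lookup t i"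
  by (auto simp: exp_le_def lookup_single when_def)

text \<open>
  Divisibility strictly decreases the total degree, so a divisor of least degree is minimal. With
  this, arbitrary (possibly infinite) generating sets of monomials can be handled without
  Dickson's lemma.
\<close>
lemma exists_minimal_exponent:
  fixes t :: "'v::finite \<Rightarrow>\<^sub>0 nat"
  assumes "P t"
  obtains m where "P m" "m \<preceq> t" "\<forall>b. P b \<longrightarrow> b \<preceq> m \<longrightarrow> b = m"
proof -
  let ?deg = "\<lambda>t :: 'v \<Rightarrow>\<^sub>0 nat. \<Sum>v\<in>UNIV. lookup t v"
  obtain m where m: "P m \<and> m \<preceq> t" and least: "\<And>b. ?deg b < ?deg m \<Longrightarrow> \<not> (P b \<and> b \<preceq> t)"
    using ex_has_least_nat[of "\<lambda>m. P m \<and> m \<preceq> t" t ?deg] assms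
    by (metis exp_le_refl not_less)
  have "\<forall>b. P b \<longrightarrow> b \<preceq> m \<longrightarrow> b = m"
  proof (intro allI impI)
    fix b assume b: "P b" "b \<preceq> m"
    then have "\<not> ?deg b < ?deg m"
      using least[of b] m exp_le_trans by blast
    then have "lookup b v = lookup m v" for v
      using b(2) sum_strict_mono_ex1[of UNIV "lookup b" "lookup m"]
      by (metis UNIV_I exp_le_def finite_UNIV le_neq_implies_less)
    then show "b = m"
      by (rule poly_mapping_eqI)
  qed
  then show ?thesis
    using m that by blast
qed

lemma inj_monom: "inj (monom :: ('v \<Rightarrow>\<^sub>0 nat) \<Rightarrow> ('v, 'k::comm_ring_1) mpoly)"
proof (rule injI)
  fix a b :: "'v \<Rightarrow>\<^sub>0 nat"
  assume "(monom a :: ('v, 'k) mpoly) = monom b"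
  then have "keys (monom a :: ('v, 'k) mpoly) = keys (monom b :: ('v, 'k) mpoly)"
    by simp
  then show "a = b"
    by (simp add: monom_def)
qed

lemma monom_0: "monom 0 = 1"
  by (simp add: monom_def)

lemma monom_mult: "monom a * monom b = monom (a + b)"
  by (simp add: monom_def mult_single)

lemma Var_power: "Var i ^ k = monom (single i k)"
proof (induction k)
  case 0
  then show ?case by (simp add: monom_def)
next
  case (Suc k)
  then show ?case
    by (simp add: Var_def monom_mult flip: single_add)
qed

lemma sum_of_terms: "f = (\<Sum>t\<in>keys f. single t (lookup f t))"
proof (rule poly_mapping_eqI)
  fix s
  have "lookup (\<Sum>t\<in>keys f. single t (lookup f t)) s = (\<Sum>t\<in>keys f. if t = s then lookup f s else 0)"
    unfolding lookup_sum by (intro sum.cong) (auto simp: lookup_single when_def)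
  then show "lookup f s = lookup (\<Sum>t\<in>keys f. single t (lookup f t)) s"
    by (simp add: in_keys_iff)
qed

lemma lookup_monom_mult: "lookup (monom a * f) (a + t) = lookup f t"
proof -
  have "lookup (monom a * f) (a + t) = lookup (\<Sum>s\<in>keys f. single (a + s) (lookup f s)) (a + t)"
    by (subst sum_of_terms[of f]) (simp add: monom_def sum_distrib_left mult_single)
  also have "\<dots> = (\<Sum>s\<in>keys f. if s = t then lookup f t else 0)"
    unfolding lookup_sum by (intro sum.cong) (auto simp: lookup_single when_def)
  also have "\<dots> = lookup f t"
    by (simp add: in_keys_iff)
  finally show ?thesis .
qed

text \<open>
  Multiplying by an arbitrary polynomial and adding can only produce terms that are multiples of
  terms already present; this is why a monomial ideal is determined by its monomials, and why all
  that follows can be done with exponent vectors.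
\<close>
lemma mem_ideal_gen_monom_iff:
  fixes f :: "('v, 'k::comm_ring_1) mpoly"
  shows "f \<in> ideal_gen (monom ` M) \<longleftrightarrow> (\<forall>t\<in>keys f. \<exists>m\<in>M. m \<preceq> t)"
proof
  let ?S = "{f :: ('v, 'k) mpoly. \<forall>t\<in>keys f. \<exists>m\<in>M. m \<preceq> t}"
  have "is_ideal ?S"
  proof (rule ideals.subspaceI)
    fix f g assume "f \<in> ?S" "g \<in> ?S"
    then show "f + g \<in> ?S"
      using keys_add[of f g] by blast
  next
    fix c f assume f: "f \<in> ?S"
    show "c * f \<in> ?S"
    proof clarify
      fix t assume "t \<in> keys (c * f)"
      then obtain a b where "t = a + b" "b \<in> keys f"
        using keys_mult[of c f] by blast
      then show "\<exists>m\<in>M. m \<preceq> t"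
        using f exp_le_trans exp_le_add by blast
    qed
  qed simp
  moreover have "monom ` M \<subseteq> ?S"
    using exp_le_refl by (fastforce simp: monom_def)
  ultimately have "ideal_gen (monom ` M) \<subseteq> ?S"
    by (intro ideals.span_minimal)
  then show "f \<in> ideal_gen (monom ` M) \<Longrightarrow> \<forall>t\<in>keys f. \<exists>m\<in>M. m \<preceq> t"
    by blast
next
  assume f: "\<forall>t\<in>keys f. \<exists>m\<in>M. m \<preceq> t"
  have "single t (lookup f t) \<in> ideal_gen (monom ` M)" if t: "t \<in> keys f" for t
  proof -
    obtain m where m: "m \<in> M" "m \<preceq> t"
      using f t by blast
    then have "single t (lookup f t) = single (t - m) (lookup f t) * monom m"
      by (simp add: monom_def mult_single exp_le_diff_add)
    then show ?thesis
      using m(1) by (simp add: ideals.span_scale ideals.span_base)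
  qed
  then have "(\<Sum>t\<in>keys f. single t (lookup f t)) \<in> ideal_gen (monom ` M)"
    by (rule ideals.span_sum)
  then show "f \<in> ideal_gen (monom ` M)"
    using sum_of_terms[of f] by simp
qed

lemma keys_monom: "keys (monom a :: ('v, 'k::comm_ring_1) mpoly) = {a}"
  by (simp add: monom_def)

lemma monom_mem_ideal_gen_monom_iff:
  "(monom a :: ('v, 'k::comm_ring_1) mpoly) \<in> ideal_gen (monom ` M) \<longleftrightarrow> (\<exists>m\<in>M. m \<preceq> a)"
  by (simp add: mem_ideal_gen_monom_iff keys_monom)

text \<open>
  Any monomial generating set contains every monomial that is minimal under divisibility in the
  ideal. If no element of \<open>M\<close> divides another one, these are all of \<open>M\<close>.
\<close>
lemma min_gens_antichain:
  assumes anti: "\<And>a b. a \<in> M \<Longrightarrow> b \<in> M \<Longrightarrow> a \<preceq> b \<Longrightarrow> a = b"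
  shows "min_gens (ideal_gen (monom ` M)) = (monom ` M :: ('v, 'k::comm_ring_1) mpoly set)"
proof -
  let ?G = "monom ` M :: ('v, 'k) mpoly set"
  have contains: "?G \<subseteq> H" if H: "H \<subseteq> range monom" "ideal_gen H = ideal_gen ?G" for H
  proof
    fix x assume "x \<in> ?G"
    then obtain m where m: "m \<in> M" "x = monom m" by blast
    obtain N where N: "H = monom ` N"
      using H(1) by (meson subset_image_iff)
    have "(monom m :: ('v, 'k) mpoly) \<in> ideal_gen H"
      unfolding H(2) using m by (auto intro: ideals.span_base)
    then obtain n where n: "n \<in> N" "n \<preceq> m"
      unfolding N monom_mem_ideal_gen_monom_iff by blast
    have "(monom n :: ('v, 'k) mpoly) \<in> ideal_gen ?G"
      unfolding H(2)[symmetric] N using n by (auto intro: ideals.span_base)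
    then obtain m' where m': "m' \<in> M" "m' \<preceq> n"
      unfolding monom_mem_ideal_gen_monom_iff by blast
    then have "m' = m"
      using anti m n exp_le_trans by blast
    then have "n = m"
      using m' n exp_le_antisym by blast
    then show "x \<in> H"
      using n m N by blast
  qed
  show ?thesis
    unfolding min_gens_def
  proof (rule the_equality)
    show "?G \<subseteq> range monom \<and> ideal_gen ?G = ideal_gen ?G \<and> (\<forall>H. H \<subset> ?G \<longrightarrow> ideal_gen H \<noteq> ideal_gen ?G)"
      using contains by blast
  next
    fix G :: "('v, 'k) mpoly set"
    assume G: "G \<subseteq> range monom \<and> ideal_gen G = ideal_gen ?G \<and> (\<forall>H. H \<subset> G \<longrightarrow> ideal_gen H \<noteq> ideal_gen ?G)"
    then have "?G \<subseteq> G"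
      by (intro contains) auto
    then show "G = ?G"
      using G by (metis psubsetI)
  qed
qed

section \<open>Ideals generated by pure powers of variables\<close>

text \<open>
  An exponent \<open>0\<close> means that the variable does not occur among the generators, so \<open>c = 0\<close> gives
  the zero ideal. Every exponent of \<open>c\<close> thus acts in the inclusion order as if \<open>0\<close> were infinite.
  The same ideals, with \<open>c\<close> the exponent of a minimal generator of \<open>I\<close>, are intersected in the
  definition of \<open>dual_ideal I\<close>.
\<close>
definition pure_power_ideal :: "('v \<Rightarrow>\<^sub>0 nat) \<Rightarrow> ('v, 'k::comm_ring_1) mpoly set"
  where "pure_power_ideal c = ideal_gen {Var i ^ lookup c i | i. lookup c i \<ge> 1}"

lemma pure_power_ideal_eq_monom:
  "pure_power_ideal c = ideal_gen (monom ` (\<lambda>i. single i (lookup c i)) ` keys c)"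
proof -
  have "{Var i ^ lookup c i | i. lookup c i \<ge> 1} = monom ` (\<lambda>i. single i (lookup c i)) ` keys c"
    by (auto simp: Var_power in_keys_iff Suc_le_eq)
  then show ?thesis
    unfolding pure_power_ideal_def by (rule arg_cong)
qed

lemma monomial_ideal_pure_power_ideal: "monomial_ideal (pure_power_ideal c)"
  unfolding monomial_ideal_def
  by (rule exI[of _ "monom ` (\<lambda>i. single i (lookup c i)) ` keys c"])
    (auto simp: pure_power_ideal_eq_monom)

lemma mem_pure_power_ideal_iff:
  "f \<in> pure_power_ideal c \<longleftrightarrow> (\<forall>t\<in>keys f. \<exists>v. 1 \<le> lookup c v \<and> lookup c v \<le> lookup t v)"
  unfolding pure_power_ideal_eq_monom mem_ideal_gen_monom_iff
  by (simp add: exp_le_single Bex_def in_keys_iff Suc_le_eq)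

lemma monom_mem_pure_power_ideal_iff:
  "monom t \<in> (pure_power_ideal c :: ('v, 'k::comm_ring_1) mpoly set)
    \<longleftrightarrow> (\<exists>v. 1 \<le> lookup c v \<and> lookup c v \<le> lookup t v)"
  by (simp add: mem_pure_power_ideal_iff keys_monom)

lemma is_ideal_pure_power_ideal: "is_ideal (pure_power_ideal c)"
  by (simp add: pure_power_ideal_def)

lemma min_gens_pure_power_ideal:
  "min_gens (pure_power_ideal c) = monom ` (\<lambda>i. single i (lookup c i)) ` keys c"
  unfolding pure_power_ideal_eq_monom
proof (rule min_gens_antichain)
  fix a b
  assume "a \<in> (\<lambda>i. single i (lookup c i)) ` keys c" "b \<in> (\<lambda>i. single i (lookup c i)) ` keys c" "a \<preceq> b"
  then obtain i j where "i \<in> keys c" "a = single i (lookup c i)" "b = single j (lookup c j)" "a \<preceq> b"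
    by blast
  then show "a = b"
    by (cases "i = j") (auto simp: exp_le_single lookup_single in_keys_iff)
qed

lemma prod_min_gens_pure_power_ideal:
  fixes c :: "'v::finite \<Rightarrow>\<^sub>0 nat"
  shows "(\<Prod>f\<in>min_gens (pure_power_ideal c). f) = (monom c :: ('v, 'k::comm_ring_1) mpoly)"
proof -
  let ?s = "\<lambda>i. single i (lookup c i)"
  have "inj_on ?s (keys c)"
  proof (rule inj_onI)
    fix i j assume ij: "i \<in> keys c" "j \<in> keys c" "?s i = ?s j"
    have "keys (?s i) = {i}" "keys (?s j) = {j}"
      using ij(1,2) by (simp_all add: in_keys_iff)
    then show "i = j"
      using ij(3) by simp
  qed
  moreover have "inj_on (monom :: _ \<Rightarrow> ('v, 'k) mpoly) (?s ` keys c)"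
    using inj_monom inj_on_subset by blast
  ultimately have "(\<Prod>f\<in>min_gens (pure_power_ideal c). f) = (\<Prod>i\<in>keys c. monom (?s i) :: ('v, 'k) mpoly)"
    by (simp add: min_gens_pure_power_ideal prod.reindex)
  also have "\<dots> = monom (\<Sum>i\<in>keys c. ?s i)"
  proof -
    have "finite A \<Longrightarrow> (\<Prod>i\<in>A. monom (?s i) :: ('v, 'k) mpoly) = monom (\<Sum>i\<in>A. ?s i)" for A
      by (induction A rule: finite_induct) (simp_all add: monom_mult monom_0)
    then show ?thesis by simp
  qed
  also have "(\<Sum>i\<in>keys c. ?s i) = c"
    using sum_of_terms[of c] by simp
  finally show ?thesis .
qed

lemma pure_power_ideal_subset_iff:
  "(pure_power_ideal c :: ('v, 'k::comm_ring_1) mpoly set) \<subseteq> pure_power_ideal b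
    \<longleftrightarrow> (\<forall>v. lookup c v \<ge> 1 \<longrightarrow> 1 \<le> lookup b v \<and> lookup b v \<le> lookup c v)"
  (is "?L \<longleftrightarrow> ?R")
proof
  assume L: ?L
  show ?R
  proof (intro allI impI)
    fix v assume v: "1 \<le> lookup c v"
    then have "monom (single v (lookup c v)) \<in> (pure_power_ideal c :: ('v, 'k) mpoly set)"
      unfolding monom_mem_pure_power_ideal_iff by (intro exI[of _ v]) simp
    then have "monom (single v (lookup c v)) \<in> (pure_power_ideal b :: ('v, 'k) mpoly set)"
      using L by blast
    then obtain w where "1 \<le> lookup b w" "lookup b w \<le> lookup (single v (lookup c v)) w"
      unfolding monom_mem_pure_power_ideal_iff by blast
    then show "1 \<le> lookup b v \<and> lookup b v \<le> lookup c v"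
      by (auto simp: lookup_single when_def split: if_splits)
  qed
next
  assume ?R
  then show ?L
    unfolding subset_iff mem_pure_power_ideal_iff by (meson le_trans)
qed

lemma pure_power_ideal_inject:
  assumes "(pure_power_ideal c :: ('v, 'k::comm_ring_1) mpoly set) = pure_power_ideal b"
  shows "c = b"
proof (rule poly_mapping_eqI)
  fix v
  have "(lookup c v \<ge> 1 \<longrightarrow> 1 \<le> lookup b v \<and> lookup b v \<le> lookup c v) \<and>
    (lookup b v \<ge> 1 \<longrightarrow> 1 \<le> lookup c v \<and> lookup c v \<le> lookup b v)"
    using assms pure_power_ideal_subset_iff[where 'k = 'k, of c b]
      pure_power_ideal_subset_iff[where 'k = 'k, of b c] by blast
  then show "lookup c v = lookup b v"
    by linarith
qed

section \<open>Irreducible monomial ideals\<close>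

text \<open>
  Numbering the variables transports the lexicographic order of \<open>nat \<Rightarrow>\<^sub>0 nat\<close>, which is compatible
  with addition, to exponent vectors in variables that carry no order of their own.
\<close>
lemma additive_injection_of_exponents:
  obtains \<phi> :: "('v::finite \<Rightarrow>\<^sub>0 nat) \<Rightarrow> (nat \<Rightarrow>\<^sub>0 nat)"
  where "inj \<phi>" "\<And>s t. \<phi> (s + t) = \<phi> s + \<phi> t"
proof -
  obtain e :: "'v \<Rightarrow> nat" where e: "inj e"
    using finite_imp_inj_to_nat_seg[of "UNIV :: 'v set"] by auto
  define \<phi> where "\<phi> t = (\<Sum>v\<in>UNIV. single (e v) (lookup t v))" for t :: "'v \<Rightarrow>\<^sub>0 nat"
  have lookup_\<phi>: "lookup (\<phi> t) (e v) = lookup t v" for t v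
  proof -
    have "lookup (\<phi> t) (e v) = (\<Sum>w\<in>UNIV. if w = v then lookup t v else 0)"
      unfolding \<phi>_def lookup_sum
      by (intro sum.cong) (auto simp: lookup_single when_def inj_eq[OF e])
    then show ?thesis by simp
  qed
  show ?thesis
  proof
    show "inj \<phi>"
      by (intro injI poly_mapping_eqI) (metis lookup_\<phi>)
    show "\<phi> (s + t) = \<phi> s + \<phi> t" for s t
      by (simp add: \<phi>_def lookup_add single_add sum.distrib)
  qed
qed

text \<open>
  The product of the leading terms, with respect to the transported order, cannot cancel.
\<close>
lemma mpoly_mult_nonzero:
  fixes f g :: "('v::finite, 'k::idom) mpoly"
  assumes "f \<noteq> 0" "g \<noteq> 0"
  shows "f * g \<noteq> 0"
proof -
  obtain \<phi> :: "('v \<Rightarrow>\<^sub>0 nat) \<Rightarrow> (nat \<Rightarrow>\<^sub>0 nat)"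
    where \<phi>: "inj \<phi>" "\<And>s t. \<phi> (s + t) = \<phi> s + \<phi> t"
    using additive_injection_of_exponents by blast
  have leading: "\<exists>t\<in>keys h. \<forall>s\<in>keys h. s \<noteq> t \<longrightarrow> \<phi> s < \<phi> t"
    if "h \<noteq> 0" for h :: "('v, 'k) mpoly"
  proof -
    have "Max (\<phi> ` keys h) \<in> \<phi> ` keys h"
      using that by (intro Max_in) auto
    then obtain t where t: "t \<in> keys h" "\<phi> t = Max (\<phi> ` keys h)"
      by force
    have "\<phi> s < \<phi> t" if s: "s \<in> keys h" "s \<noteq> t" for s
    proof -
      have "\<phi> s \<le> \<phi> t"
        using s t(2) by simp
      then show ?thesis
        using s \<phi>(1) by (metis injD le_neq_trans)
    qed
    then show ?thesis using t by blast
  qed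
  obtain a where a: "a \<in> keys f" "\<And>s. s \<in> keys f \<Longrightarrow> s \<noteq> a \<Longrightarrow> \<phi> s < \<phi> a"
    using leading[OF assms(1)] by blast
  obtain b where b: "b \<in> keys g" "\<And>s. s \<in> keys g \<Longrightarrow> s \<noteq> b \<Longrightarrow> \<phi> s < \<phi> b"
    using leading[OF assms(2)] by blast
  define f' where "f' = f - single a (lookup f a)"
  define g' where "g' = g - single b (lookup g b)"
  have f': "\<phi> s < \<phi> a" if "s \<in> keys f'" for s
    using that a by (cases "s = a") (auto simp: f'_def in_keys_iff lookup_minus lookup_single)
  have g': "\<phi> s < \<phi> b" if "s \<in> keys g'" for s
    using that b by (cases "s = b") (auto simp: g'_def in_keys_iff lookup_minus lookup_single)
  have b_le: "\<phi> s \<le> \<phi> b" if "s \<in> keys g" for s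
    using b that by (metis less_imp_le order_refl)
  have 1: "lookup (f' * g) (a + b) = 0"
  proof (rule ccontr)
    assume "lookup (f' * g) (a + b) \<noteq> 0"
    then obtain s t where st: "s \<in> keys f'" "t \<in> keys g" "a + b = s + t"
      using keys_mult[of f' g] by (auto simp: in_keys_iff)
    have "\<phi> s + \<phi> t < \<phi> a + \<phi> b"
      using f'[OF st(1)] b_le[OF st(2)] by (rule add_less_le_mono)
    then show False
      using st(3) \<phi>(2) by (metis less_irrefl)
  qed
  have 2: "lookup (single a (lookup f a) * g') (a + b) = 0"
  proof (rule ccontr)
    assume "lookup (single a (lookup f a) * g') (a + b) \<noteq> 0"
    then obtain s t where st: "s \<in> keys (single a (lookup f a))" "t \<in> keys g'" "a + b = s + t"
      using keys_mult[of "single a (lookup f a)" g'] by (auto simp only: in_keys_iff)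
    then have "s = a"
      by (auto split: if_splits)
    have "\<phi> a + \<phi> t < \<phi> a + \<phi> b"
      using g'[OF st(2)] by (rule add_strict_left_mono)
    then show False
      using st(3) \<open>s = a\<close> \<phi>(2) by (metis less_irrefl)
  qed
  have "f * g = f' * g + (single a (lookup f a) * g' + single a (lookup f a) * single b (lookup g b))"
    by (simp add: f'_def g'_def algebra_simps)
  then have "lookup (f * g) (a + b) = lookup f a * lookup g b"
    using 1 2 by (simp add: lookup_add mult_single)
  then show ?thesis
    using a b by (auto simp: in_keys_iff)
qed

text \<open>
  The monomial with this exponent spans the socle modulo \<open>pure_power_ideal c\<close>, over the
  polynomials in the variables that do not occur in \<open>c\<close>: multiplying it by any variable of \<open>c\<close>
  leads into the ideal.
\<close>
definition socle_exponent :: "('v \<Rightarrow>\<^sub>0 nat) \<Rightarrow> ('v \<Rightarrow>\<^sub>0 nat)"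
  where "socle_exponent c = Poly_Mapping.map (\<lambda>k. k - 1) c"

lemma lookup_socle_exponent: "lookup (socle_exponent c) v = lookup c v - 1"
  by (simp add: socle_exponent_def Poly_Mapping.map.rep_eq when_def)

text \<open>
  Every polynomial outside \<open>pure_power_ideal c\<close> can be pushed into the socle without vanishing.
  Among its terms outside the ideal choose one, \<open>e\<close>, of least degree in the variables of \<open>c\<close>, and
  multiply by the monomial \<open>p\<close> that raises the part of \<open>e\<close> in these variables to the socle exponent.
  Terms in the ideal stay there. A term outside with another part in these variables exceeds \<open>e\<close> in
  one of them, so \<open>p\<close> moves it into the ideal. What remains is the socle monomial times a polynomial \<open>g\<close> in the other variables.
\<close>
lemma socle_multiple:
  fixes f :: "('v::finite, 'k::comm_ring_1) mpoly"
  assumes "f \<notin> pure_power_ideal c"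
  obtains p g where "g \<noteq> 0"
    "\<forall>t\<in>keys g. \<forall>v. lookup c v \<ge> 1 \<longrightarrow> lookup t v = 0"
    "monom p * f - monom (socle_exponent c) * g \<in> pure_power_ideal c"
proof -
  define S where "S = {v. lookup c v \<ge> 1}"
  let ?c1 = "socle_exponent c"
  let ?deg = "\<lambda>t :: 'v \<Rightarrow>\<^sub>0 nat. \<Sum>v\<in>S. lookup t v"
  let ?P = "\<lambda>t. t \<in> keys f \<and> (\<forall>v\<in>S. lookup t v < lookup c v)"
  obtain t where "t \<in> keys f" "\<not> (\<exists>v. 1 \<le> lookup c v \<and> lookup c v \<le> lookup t v)"
    using assms unfolding mem_pure_power_ideal_iff by blast
  then have "t \<in> keys f" "\<forall>v\<in>S. \<not> lookup c v \<le> lookup t v"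
    unfolding S_def by blast+
  then have "?P t"
    by (simp add: not_le)
  from ex_has_least_nat[of ?P, OF this, of ?deg]
  obtain e where "?P e \<and> (\<forall>t. ?P t \<longrightarrow> ?deg e \<le> ?deg t)" ..
  then have e: "?P e" and least: "\<And>t. ?P t \<Longrightarrow> ?deg e \<le> ?deg t"
    by simp_all
  \<comment> \<open>The part of a monomial in the variables that occur in \<open>c\<close>.\<close>
  define r where "r t = Abs_poly_mapping (\<lambda>v. if v \<in> S then lookup t v else 0)" for t :: "'v \<Rightarrow>\<^sub>0 nat"
  have r: "lookup (r t) v = (if v \<in> S then lookup t v else 0)" for t v
    by (simp add: r_def)
  define T where "T = {t \<in> keys f. r t = r e}"
  define p where "p = ?c1 - r e"
  define g where "g = (\<Sum>t\<in>T. single (t - r e) (lookup f t))"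
  have fin: "finite T"
    by (simp add: T_def)
  have le: "t - r e + r e = t" if "t \<in> T" for t
  proof -
    have "r t \<preceq> t"
      by (simp add: exp_le_def r)
    then have "r e \<preceq> t"
      using that by (simp add: T_def)
    then show ?thesis by (rule exp_le_diff_add)
  qed
  have "lookup (r e) v \<le> lookup ?c1 v" for v
    using e unfolding r lookup_socle_exponent by (cases "v \<in> S") (auto dest!: bspec[of S _ v])
  then have p_re: "p + r e = ?c1"
    unfolding p_def by (intro exp_le_diff_add) (simp add: exp_le_def)
  have p_add: "p + t = ?c1 + (t - r e)" if "t \<in> T" for t
  proof -
    have "p + t = p + (t - r e + r e)"
      by (simp only: le[OF that])
    also have "\<dots> = (p + r e) + (t - r e)"
      by (simp only: ac_simps)
    finally show ?thesis
      by (simp only: p_re)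
  qed
  have terms: "monom p * f - monom ?c1 * g = (\<Sum>t\<in>keys f - T. single (p + t) (lookup f t))"
  proof -
    have "monom p * f = monom p * (\<Sum>t\<in>keys f. single t (lookup f t))"
      by (rule arg_cong[OF sum_of_terms])
    also have "\<dots> = (\<Sum>t\<in>keys f. single (p + t) (lookup f t))"
      by (simp add: monom_def sum_distrib_left mult_single)
    also have "\<dots> = (\<Sum>t\<in>keys f - T. single (p + t) (lookup f t)) + (\<Sum>t\<in>T. single (p + t) (lookup f t))"
      by (rule sum.subset_diff) (auto simp: T_def)
    also have "(\<Sum>t\<in>T. single (p + t) (lookup f t)) = monom ?c1 * g"
      unfolding g_def monom_def sum_distrib_left mult_single
      by (intro sum.cong refl) (simp add: p_add)
    finally show ?thesis by simp
  qed
  have "keys g \<subseteq> (\<Union>t\<in>T. keys (single (t - r e) (lookup f t)))"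
    unfolding g_def by (rule keys_sum)
  also have "\<dots> \<subseteq> (\<lambda>t. t - r e) ` T"
    by (auto split: if_splits)
  finally have keys_g: "keys g \<subseteq> (\<lambda>t. t - r e) ` T" .
  have "e \<in> T"
    using e by (simp add: T_def)
  then have diff_eq_iff: "t - r e = e - r e \<longleftrightarrow> t = e" if "t \<in> T" for t
    using le that by metis
  have "lookup g (e - r e) = (\<Sum>t\<in>T. if t = e then lookup f e else 0)"
    unfolding g_def lookup_sum
    by (intro sum.cong refl) (simp add: lookup_single when_def diff_eq_iff)
  also have "\<dots> = lookup f e"
    using \<open>e \<in> T\<close> fin by simp
  finally have "g \<noteq> 0"
    using e by (auto simp: in_keys_iff)
  moreover have "\<forall>t\<in>keys g. \<forall>v. lookup c v \<ge> 1 \<longrightarrow> lookup t v = 0"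
  proof (intro ballI allI impI)
    fix t v assume t: "t \<in> keys g" and v: "lookup c v \<ge> 1"
    obtain s where s: "s \<in> T" "t = s - r e"
      using keys_g t by blast
    then have "lookup (r e) v = lookup (r s) v"
      by (simp add: T_def)
    then show "lookup t v = 0"
      using s v by (simp add: r S_def lookup_minus)
  qed
  moreover have "monom p * f - monom ?c1 * g \<in> pure_power_ideal c"
    unfolding terms
  proof (rule ideals.subspace_sum[OF is_ideal_pure_power_ideal])
    fix t assume t: "t \<in> keys f - T"
    have "\<exists>v\<in>S. lookup c v \<le> lookup (p + t) v"
    proof (cases "?P t")
      case False
      then show ?thesis
        using t by (auto simp: lookup_add not_less intro: trans_le_add2)
    next
      case True
      have "\<exists>v\<in>S. lookup e v < lookup t v"
      proof (rule ccontr)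
        assume "\<not> ?thesis"
        then have "\<forall>v\<in>S. lookup t v \<le> lookup e v"
          by (auto simp: not_less)
        moreover have "\<not> ?deg t < ?deg e"
          using least[OF True] by simp
        ultimately have "\<forall>v\<in>S. lookup t v = lookup e v"
          by (meson finite le_neq_implies_less sum_strict_mono_ex1)
        then have "r t = r e"
          by (intro poly_mapping_eqI) (simp add: r)
        then show False
          using t by (simp add: T_def)
      qed
      then obtain v where v: "v \<in> S" "lookup e v < lookup t v" by blast
      then have "lookup c v \<le> lookup (p + t) v"
        using bspec[OF conjunct2[OF e] v(1)]
        by (simp add: lookup_add p_def lookup_minus r lookup_socle_exponent)
      then show ?thesis using v by blast
    qed
    then show "single (p + t) (lookup f t) \<in> pure_power_ideal c"
      by (auto simp: mem_pure_power_ideal_iff S_def split: if_splits)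
  qed
  ultimately show ?thesis
    by (rule that)
qed

text \<open>
  Two ideals \<open>A\<close>, \<open>B\<close> strictly above \<open>pure_power_ideal c\<close> contain socle elements
  \<open>x * g\<close> and \<open>x * h\<close>, where \<open>x\<close> is the socle monomial and \<open>g\<close>, \<open>h\<close> are nonzero polynomials in the
  variables outside \<open>c\<close>. Then \<open>x * (g * h)\<close> lies in both, but not in \<open>pure_power_ideal c\<close>, because
  \<open>g * h\<close> is nonzero. So the intersection of \<open>A\<close> and \<open>B\<close> is strictly larger.
\<close>
lemma irreducible_pure_power_ideal:
  fixes c :: "'v::finite \<Rightarrow>\<^sub>0 nat"
  shows "irreducible_ideal (pure_power_ideal c :: ('v, 'k::idom) mpoly set)"
proof -
  let ?Q = "pure_power_ideal c :: ('v, 'k) mpoly set"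
  let ?c1 = "socle_exponent c"
  let ?x = "monom ?c1 :: ('v, 'k) mpoly"
  have "monom 0 \<notin> ?Q"
    unfolding monom_mem_pure_power_ideal_iff by auto
  then have proper: "?Q \<noteq> UNIV" by blast
  have False if AB: "is_ideal A" "is_ideal B" "?Q \<subset> A" "?Q \<subset> B" "?Q = A \<inter> B" for A B
  proof -
    have socle: "\<exists>g. g \<noteq> 0 \<and> (\<forall>t\<in>keys g. \<forall>v. lookup c v \<ge> 1 \<longrightarrow> lookup t v = 0) \<and> ?x * g \<in> A"
      if A: "is_ideal A" "?Q \<subset> A" for A
    proof -
      obtain f where f: "f \<in> A" "f \<notin> ?Q" using A(2) by blast
      obtain p g where g: "g \<noteq> 0" "\<forall>t\<in>keys g. \<forall>v. lookup c v \<ge> 1 \<longrightarrow> lookup t v = 0"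
          "monom p * f - ?x * g \<in> ?Q"
        by (rule socle_multiple[OF f(2)]) (rule that)
      have "monom p * f \<in> A"
        using A(1) f(1) by (rule ideals.subspace_scale)
      moreover have "monom p * f - ?x * g \<in> A"
        using A(2) g(3) by blast
      ultimately have "monom p * f - (monom p * f - ?x * g) \<in> A"
        by (rule ideals.subspace_diff[OF A(1)])
      then show ?thesis using g(1,2) by auto
    qed
    obtain g where g: "g \<noteq> 0" "\<forall>t\<in>keys g. \<forall>v. lookup c v \<ge> 1 \<longrightarrow> lookup t v = 0" "?x * g \<in> A"
      using socle[OF AB(1,3)] by blast
    obtain h where h: "h \<noteq> 0" "\<forall>t\<in>keys h. \<forall>v. lookup c v \<ge> 1 \<longrightarrow> lookup t v = 0" "?x * h \<in> B"
      using socle[OF AB(2,4)] by blast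
    have "?x * (g * h) \<in> A"
      using ideals.subspace_scale[OF AB(1) g(3), of h] by (simp only: ac_simps)
    moreover have "?x * (g * h) \<in> B"
      using ideals.subspace_scale[OF AB(2) h(3), of g] by (simp only: ac_simps)
    ultimately have xgh: "?x * (g * h) \<in> ?Q"
      unfolding AB(5) by (rule IntI)
    have "g * h \<noteq> 0"
      using g h mpoly_mult_nonzero by blast
    then obtain t where t: "t \<in> keys (g * h)"
      by (metis poly_mapping_eqI lookup_zero in_keys_iff)
    have "?c1 + t \<in> keys (?x * (g * h))"
      using t unfolding in_keys_iff lookup_monom_mult .
    with xgh obtain v where v: "lookup c v \<ge> 1" "lookup c v \<le> lookup (?c1 + t) v"
      unfolding mem_pure_power_ideal_iff by blast
    obtain s s' where "s \<in> keys g" "s' \<in> keys h" "t = s + s'"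
      using t keys_mult[of g h] by blast
    then have "lookup t v = 0"
      using g(2) h(2) v(1) by (simp add: lookup_add)
    then show False
      using v by (simp add: lookup_add lookup_socle_exponent)
  qed
  then show ?thesis
    unfolding irreducible_ideal_def using proper is_ideal_pure_power_ideal by blast
qed

text \<open>
  If a minimal monomial \<open>a\<close> of \<open>J\<close> factors as \<open>p * q\<close> with \<open>p\<close>, \<open>q\<close> coprime and both outside \<open>J\<close>,
  then \<open>J\<close> is the intersection of the larger ideals \<open>J + (p)\<close> and \<open>J + (q)\<close>: a monomial divisible by
  \<open>p\<close> and by \<open>q\<close> is divisible by \<open>a\<close>. So the minimal monomials of an irreducible \<open>J\<close> are powers of a
  variable, and \<open>c\<close> collects the least power of each variable that belongs to \<open>J\<close>.
\<close>
lemma irreducible_monomial_ideal_is_pure_power_ideal: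
  fixes J :: "('v::finite, 'k::comm_ring_1) mpoly set"
  assumes "monomial_ideal J" "irreducible_ideal J"
  obtains c where "J = pure_power_ideal c"
proof -
  obtain M where M: "J = ideal_gen (monom ` M)"
    using assms(1) unfolding monomial_ideal_def by (metis subset_imageE)
  have ideal_J: "is_ideal J" and proper: "J \<noteq> UNIV"
    using assms(2) by (auto simp: irreducible_ideal_def)
  have mem_J: "monom a \<in> J \<longleftrightarrow> (\<exists>m\<in>M. m \<preceq> a)" for a
    unfolding M by (rule monom_mem_ideal_gen_monom_iff)
  have J_up: "monom b \<in> J" if "monom a \<in> J" "a \<preceq> b" for a b
    using that unfolding mem_J by (meson exp_le_trans)
  have pure: "\<exists>v k. 1 \<le> k \<and> k \<le> lookup m v \<and> monom (single v k) \<in> J" if m: "monom m \<in> J" for m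
  proof -
    obtain a where a: "monom a \<in> J" "a \<preceq> m" "\<forall>b. monom b \<in> J \<longrightarrow> b \<preceq> a \<longrightarrow> b = a"
      by (rule exists_minimal_exponent[of "\<lambda>a. monom a \<in> J", OF m]) (rule that)
    have "a \<noteq> 0"
    proof
      assume "a = 0"
      then have "1 \<in> J"
        using a(1) by (simp add: monom_0)
      then have "f * 1 \<in> J" for f
        using ideal_J ideals.subspace_scale by blast
      then show False
        using proper by auto
    qed
    then obtain v where v: "lookup a v \<noteq> 0"
      by (metis poly_mapping_eqI lookup_zero)
    define p where "p = single v (lookup a v)"
    define q where "q = a - p"
    have q: "lookup q w = (if w = v then 0 else lookup a w)" for w
      by (simp add: q_def p_def lookup_minus lookup_single when_def)
    have "monom q \<notin> J"
    proof
      assume "monom q \<in> J"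
      moreover have "q \<preceq> a"
        by (simp add: exp_le_def q)
      ultimately have "q = a"
        using a(3) by blast
      then show False
        using v q[of v] by simp
    qed
    have "monom p \<in> J"
    proof (rule ccontr)
      assume "monom p \<notin> J"
      let ?A = "ideal_gen (monom ` insert p M) :: ('v, 'k) mpoly set"
      let ?B = "ideal_gen (monom ` insert q M) :: ('v, 'k) mpoly set"
      have "J \<subseteq> ?A" "J \<subseteq> ?B"
        unfolding M by (auto intro!: ideals.span_mono)
      moreover have "monom p \<in> ?A" "monom q \<in> ?B"
        by (auto intro: ideals.span_base)
      ultimately have "J \<subset> ?A" "J \<subset> ?B"
        using \<open>monom p \<notin> J\<close> \<open>monom q \<notin> J\<close> by blast+
      moreover have "?A \<inter> ?B \<subseteq> J"
      proof
        fix f assume f: "f \<in> ?A \<inter> ?B"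
        have "\<exists>m\<in>M. m \<preceq> t" if t: "t \<in> keys f" for t
        proof -
          have "(\<exists>m\<in>insert p M. m \<preceq> t) \<and> (\<exists>m\<in>insert q M. m \<preceq> t)"
            using f t unfolding Int_iff mem_ideal_gen_monom_iff by blast
          then consider "\<exists>m\<in>M. m \<preceq> t" | "p \<preceq> t" "q \<preceq> t"
            by blast
          then show ?thesis
          proof cases
            case 2
            have "lookup a v \<le> lookup t v"
              using 2(1) unfolding p_def exp_le_single .
            moreover have "lookup a w \<le> lookup t w" if "w \<noteq> v" for w
              using 2(2) q[of w] that unfolding exp_le_def by metis
            ultimately have "lookup a w \<le> lookup t w" for w
              by (cases "w = v") auto
            then have "a \<preceq> t"
              by (simp add: exp_le_def)
            then show ?thesis
              using J_up[OF a(1)] mem_J by blast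
          qed
        qed
        then show "f \<in> J"
          unfolding M mem_ideal_gen_monom_iff by blast
      qed
      ultimately have "J = ?A \<inter> ?B"
        using \<open>J \<subseteq> ?A\<close> \<open>J \<subseteq> ?B\<close> by blast
      then show False
        using assms(2) \<open>J \<subset> ?A\<close> \<open>J \<subset> ?B\<close> unfolding irreducible_ideal_def
        by (metis ideals.subspace_span)
    qed
    then show ?thesis
      using v a(2) by (intro exI[of _ v] exI[of _ "lookup a v"]) (auto simp: p_def exp_le_def Suc_le_eq)
  qed
  define P where "P v k \<longleftrightarrow> 1 \<le> k \<and> monom (single v k) \<in> J" for v k
  define c where "c = Abs_poly_mapping (\<lambda>v. if \<exists>k. P v k then LEAST k. P v k else 0)"
  have c: "lookup c v = (if \<exists>k. P v k then LEAST k. P v k else 0)" for v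
    by (simp add: c_def)
  have c_mem: "monom (single v (lookup c v)) \<in> J" if "lookup c v \<ge> 1" for v
  proof -
    have "P v (lookup c v)"
      using that LeastI_ex[of "P v"] by (auto simp: c split: if_splits)
    then show ?thesis
      by (simp add: P_def)
  qed
  have c_le: "1 \<le> lookup c v \<and> lookup c v \<le> k" if "P v k" for v k
  proof -
    have "P v (LEAST k. P v k)" "(LEAST k. P v k) \<le> k"
      using that by (auto intro: LeastI Least_le)
    then show ?thesis
      using that by (auto simp: c P_def)
  qed
  have "pure_power_ideal c \<subseteq> J"
    unfolding pure_power_ideal_def Var_power using c_mem ideal_J by (intro ideals.span_minimal) auto
  moreover have "J \<subseteq> pure_power_ideal c"
    unfolding M
  proof (rule ideals.span_minimal[OF _ is_ideal_pure_power_ideal], clarify)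
    fix m assume "m \<in> M"
    then have "monom m \<in> J"
      unfolding mem_J using exp_le_refl by blast
    then obtain v k where "k \<le> lookup m v" "P v k"
      using pure unfolding P_def by blast
    then show "monom m \<in> (pure_power_ideal c :: ('v, 'k) mpoly set)"
      unfolding monom_mem_pure_power_ideal_iff using c_le le_trans by blast
  qed
  ultimately show ?thesis
    using that by blast
qed

section \<open>Uniqueness of the irreducible components\<close>

text \<open>
  Otherwise choose in each \<open>J\<close> a pure power outside \<open>pure_power_ideal b\<close>. The least common multiple
  of the chosen powers lies in every \<open>J\<close>. It is not in \<open>pure_power_ideal b\<close>: its exponent in each
  variable is \<open>0\<close> or that of one of the chosen powers, and these avoid the ideal.
\<close>
lemma Inter_pure_power_ideals_subset:
  fixes b :: "'v::finite \<Rightarrow>\<^sub>0 nat"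
  assumes "finite C" "C \<subseteq> range pure_power_ideal"
    and "\<Inter>C \<subseteq> (pure_power_ideal b :: ('v, 'k::comm_ring_1) mpoly set)"
  shows "\<exists>J\<in>C. J \<subseteq> pure_power_ideal b"
proof (rule ccontr)
  let ?Q = "pure_power_ideal b :: ('v, 'k) mpoly set"
  assume "\<not> ?thesis"
  with assms(1,2) have "\<exists>t. monom t \<in> \<Inter>C \<and> monom t \<notin> ?Q"
  proof (induction C rule: finite_induct)
    case empty
    have "monom 0 \<notin> ?Q"
      unfolding monom_mem_pure_power_ideal_iff by auto
    then show ?case by auto
  next
    case (insert J C)
    obtain t where t: "monom t \<in> \<Inter>C" "monom t \<notin> ?Q"
      using insert by auto
    obtain c where c: "J = pure_power_ideal c"
      using insert.prems by auto
    have "\<not> pure_power_ideal c \<subseteq> ?Q"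
      using insert.prems c by auto
    then obtain v where v: "lookup c v \<ge> 1" "\<not> (1 \<le> lookup b v \<and> lookup b v \<le> lookup c v)"
      unfolding pure_power_ideal_subset_iff by blast
    define s where "s = Abs_poly_mapping (\<lambda>w. if w = v then max (lookup t v) (lookup c v) else lookup t w)"
    have s: "lookup s w = (if w = v then max (lookup t v) (lookup c v) else lookup t w)" for w
      by (simp add: s_def)
    have "monom s \<in> K" if K: "K \<in> C" for K
    proof -
      obtain a where a: "K = pure_power_ideal a"
        using insert.prems(1) K by blast
      then have "monom t \<in> (pure_power_ideal a :: ('v, 'k) mpoly set)"
        using t(1) K by blast
      moreover have "lookup t w \<le> lookup s w" for w
        by (simp add: s)
      ultimately show ?thesis
        unfolding a monom_mem_pure_power_ideal_iff using le_trans by blast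
    qed
    moreover have "monom s \<in> J"
      unfolding c monom_mem_pure_power_ideal_iff using v(1) by (intro exI[of _ v]) (simp add: s)
    moreover have "monom s \<notin> ?Q"
      using t(2) v(2) unfolding monom_mem_pure_power_ideal_iff s by (auto simp: le_max_iff_disj)
    ultimately show ?case by auto
  qed
  then show False
    using assms(3) by blast
qed

text \<open>
  The members of a finite family that are minimal under inclusion have the same intersection, and
  the preceding lemma shows that none of them can be omitted. If \<open>D\<close> is another irredundant
  decomposition, each minimal \<open>J\<close> contains some \<open>K\<close> in \<open>D\<close>, which in turn contains a member of
  \<open>F\<close>; minimality forces \<open>K = J\<close>. So \<open>D\<close> contains the minimal members, and equals their set by
  irredundancy.
\<close>
lemma irreducible_components_Inter:
  fixes F :: "('v::finite, 'k::idom) mpoly set set"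
  assumes F: "finite F" "F \<subseteq> range pure_power_ideal"
  shows "irreducible_components (\<Inter>F) = {J \<in> F. \<forall>J'\<in>F. J' \<subseteq> J \<longrightarrow> J' = J}"
proof -
  let ?C = "{J \<in> F. \<forall>J'\<in>F. J' \<subseteq> J \<longrightarrow> J' = J}"
  have below: "\<exists>J'\<in>?C. J' \<subseteq> J" if J: "J \<in> F" for J
  proof -
    obtain J' where "J' \<in> F" "J' \<subseteq> J" "\<forall>K\<in>F. K \<subseteq> J' \<longrightarrow> J' = K"
      using finite_has_minimal2[OF F(1) J] by blast
    then show ?thesis by auto
  qed
  have Inter_C: "\<Inter>?C = \<Inter>F"
    using below by blast
  have pure: "\<exists>J'\<in>D. J' \<subseteq> J" if D: "finite D" "D \<subseteq> range pure_power_ideal" "\<Inter>D = \<Inter>F" and J: "J \<in> F" for D J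
  proof -
    obtain b where "J = pure_power_ideal b"
      using F(2) J by blast
    then show ?thesis
      using D J Inter_pure_power_ideals_subset[of D b] by blast
  qed
  have "irredundant_irreducible_decomposition ?C (\<Inter>F)"
    unfolding irredundant_irreducible_decomposition_def
  proof (intro conjI ballI allI impI)
    fix J assume "J \<in> ?C"
    then obtain c where c: "J = pure_power_ideal c"
      using F(2) by blast
    show "monomial_ideal J"
      unfolding c by (rule monomial_ideal_pure_power_ideal)
    show "irreducible_ideal J"
      unfolding c by (rule irreducible_pure_power_ideal)
  next
    fix C' assume "C' \<subset> ?C"
    show "\<Inter>C' \<noteq> \<Inter>F"
    proof
      assume "\<Inter>C' = \<Inter>F"
      obtain J where J: "J \<in> ?C" "J \<notin> C'"
        using \<open>C' \<subset> ?C\<close> by blast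
      have "finite C'" "C' \<subseteq> range pure_power_ideal"
        using \<open>C' \<subset> ?C\<close> F by (auto intro: finite_subset)
      then obtain J' where "J' \<in> C'" "J' \<subseteq> J"
        using pure[of C' J] \<open>\<Inter>C' = \<Inter>F\<close> J by blast
      then show False
        using J \<open>C' \<subset> ?C\<close> by blast
    qed
  qed (use F Inter_C in auto)
  moreover have "D = ?C" if D: "irredundant_irreducible_decomposition D (\<Inter>F)" for D
  proof -
    have D_pure: "D \<subseteq> range pure_power_ideal"
    proof
      fix J assume "J \<in> D"
      then have "monomial_ideal J" "irreducible_ideal J"
        using D by (auto simp: irredundant_irreducible_decomposition_def)
      then show "J \<in> range pure_power_ideal"
        by (metis irreducible_monomial_ideal_is_pure_power_ideal rangeI)
    qed
    have D': "finite D" "\<Inter>D = \<Inter>F" "\<And>C'. C' \<subset> D \<Longrightarrow> \<Inter>C' \<noteq> \<Inter>F"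
      using D by (auto simp: irredundant_irreducible_decomposition_def)
    have "?C \<subseteq> D"
    proof
      fix J assume J: "J \<in> ?C"
      then obtain K where K: "K \<in> D" "K \<subseteq> J"
        using pure[OF D'(1) D_pure D'(2)] by blast
      then obtain b where b: "K = pure_power_ideal b"
        using D_pure by blast
      have "\<Inter>F \<subseteq> pure_power_ideal b"
        using D'(2) K(1) b by blast
      then obtain J' where "J' \<in> F" "J' \<subseteq> K"
        using Inter_pure_power_ideals_subset[OF F] b by blast
      then have "J' = J"
        using J K by blast
      then have "K = J"
        using \<open>J' \<subseteq> K\<close> K(2) by simp
      then show "J \<in> D"
        using K(1) by simp
    qed
    then show ?thesis
      using D'(3)[of ?C] Inter_C by blast
  qed
  ultimately show ?thesis
    unfolding irreducible_components_def by (rule the_equality)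
qed

section \<open>Covers of a transitive graph\<close>

text \<open>
  These \<open>u\<close> turn out to be the exponents of the monomials in the dual of the edge ideal: each
  arrow \<open>(i, j)\<close> contributes the ideal generated by \<open>x\<^sub>i\<close> and the \<open>d j\<close>-th power of \<open>x\<^sub>j\<close>.
\<close>
definition edge_cover :: "('v \<times> 'v) set \<Rightarrow> ('v \<Rightarrow> nat) \<Rightarrow> ('v \<Rightarrow> nat) \<Rightarrow> bool"
  where "edge_cover E d u \<longleftrightarrow> (\<forall>(i, j)\<in>E. u i \<ge> 1 \<or> u j \<ge> d j)"

lemma edge_cover_mono:
  assumes "edge_cover E d u" "\<And>v. u v \<le> w v"
  shows "edge_cover E d w"
  unfolding edge_cover_def
proof clarify
  fix i j assume "(i, j) \<in> E" "\<not> d j \<le> w j"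
  then have "u i \<ge> 1"
    using assms(1) le_trans[OF _ assms(2)[of j]] by (auto simp: edge_cover_def)
  then show "1 \<le> w i"
    using assms(2) le_trans by blast
qed

text \<open>
  The edge ideal is contained in \<open>pure_power_ideal c\<close> iff each arrow \<open>(i, j)\<close> satisfies \<open>c i = 1\<close> or
  \<open>1 \<le> c j \<le> d j\<close>. The values are restricted to \<open>0\<close>, \<open>1\<close> and \<open>d v\<close>, which makes the last
  upper bound automatic and leaves finitely many ideals; they suffice to cut out the edge ideal.
\<close>
definition edge_containing :: "('v \<times> 'v) set \<Rightarrow> ('v \<Rightarrow> nat) \<Rightarrow> ('v \<Rightarrow> nat) \<Rightarrow> bool"
  where "edge_containing E d c \<longleftrightarrow>
    (\<forall>v. c v \<in> {0, 1, d v}) \<and> (\<forall>(i, j)\<in>E. c i = 1 \<or> c j \<ge> 1)"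

text \<open>
  Inclusion of \<open>pure_power_ideal b\<close> in \<open>pure_power_ideal c\<close>, for plain functions. Irreducible
  components are given by those \<open>c\<close> that only \<open>c\<close> itself refines.
\<close>
definition refines :: "('v \<Rightarrow> nat) \<Rightarrow> ('v \<Rightarrow> nat) \<Rightarrow> bool"
  where "refines b c \<longleftrightarrow> (\<forall>v. b v \<ge> 1 \<longrightarrow> 1 \<le> c v \<and> c v \<le> b v)"

text \<open>
  Suppose that the arrow \<open>(i, j)\<close> is not covered: \<open>c i = 0\<close> and \<open>0 < c j < d j\<close>. Raising \<open>c j\<close> to
  \<open>d j\<close> makes the ideal smaller, so by maximality of the exponent it no longer contains the edge
  ideal. The arrow responsible starts at \<open>j\<close>, say \<open>(j, l)\<close>, and has \<open>c l = 0\<close>. Transitivity provides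
  the arrow \<open>(i, l)\<close>, which contradicts \<open>c i = c l = 0\<close>.
\<close>
lemma maximal_edge_containing_is_cover:
  assumes E: "trans E" and d: "\<And>v. d v \<ge> 1"
    and c: "edge_containing E d c"
    and maximal: "\<And>b. edge_containing E d b \<Longrightarrow> refines b c \<Longrightarrow> b = c"
  shows "edge_cover E d c"
  unfolding edge_cover_def
proof clarify
  fix i j assume ij: "(i, j) \<in> E" and weak: "\<not> d j \<le> c j"
  have edge: "c k = 1 \<or> c l \<ge> 1" if "(k, l) \<in> E" for k l
    using c that by (auto simp: edge_containing_def)
  show "1 \<le> c i"
  proof (rule ccontr)
    assume "\<not> 1 \<le> c i"
    then have "c i = 0" by simp
    then have "c j \<ge> 1"
      using edge[OF ij] by simp
    define b where "b = c(j := d j)"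
    have "refines b c"
      using \<open>c j \<ge> 1\<close> weak by (auto simp: refines_def b_def)
    moreover have "b \<noteq> c"
      using weak by (metis b_def fun_upd_same order_refl)
    ultimately have "\<not> edge_containing E d b"
      using maximal by blast
    moreover have "\<forall>v. b v \<in> {0, 1, d v}"
      using c by (auto simp: b_def edge_containing_def)
    ultimately have "\<not> (\<forall>(i, j)\<in>E. b i = 1 \<or> b j \<ge> 1)"
      unfolding edge_containing_def by blast
    then obtain k l where kl: "(k, l) \<in> E" "b k \<noteq> 1" "b l = 0"
      by force
    have "l \<noteq> j"
      using kl(3) d[of j] by (auto simp: b_def)
    then have "c l = 0"
      using kl(3) by (simp add: b_def)
    then have "k = j"
      using edge[OF kl(1)] kl(2) by (auto simp: b_def split: if_splits)
    then have "(i, l) \<in> E"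
      using transD[OF E ij] kl(1) by blast
    then show False
      using edge \<open>c i = 0\<close> \<open>c l = 0\<close> by fastforce
  qed
qed

text \<open>
  This is how a component below a given cover is found: it is a minimal ideal contained in the one
  generated by the variables in the support of the cover.
\<close>
lemma edge_containing_support_of_cover:
  assumes "\<And>v. d v \<ge> 1" "edge_cover E d u"
  shows "edge_containing E d (\<lambda>v. if u v \<ge> 1 then 1 else 0)"
proof -
  have "u i \<ge> 1 \<or> u j \<ge> 1" if "(i, j) \<in> E" for i j
  proof -
    have "u i \<ge> 1 \<or> d j \<le> u j"
      using assms(2) that by (auto simp: edge_cover_def)
    then show ?thesis
      using assms(1)[of j] by linarith
  qed
  then have "\<forall>(i, j)\<in>E. u i \<ge> 1 \<or> u j \<ge> 1"
    by blast
  then show ?thesis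
    unfolding edge_containing_def by fastforce
qed

text \<open>
  The support of \<open>b\<close> lies in that of \<open>u\<close>, and \<open>b v \<le> d v\<close> whenever \<open>b v\<close> is positive; so only vertices
  \<open>v\<close> with \<open>0 < u v < d v\<close> matter. By minimality of \<open>u\<close>, such a vertex is needed for an arrow
  \<open>(v, j)\<close> with \<open>u j < d j\<close>. If \<open>u j > 0\<close>, the same applies to \<open>j\<close>; since \<open>E\<close> has no cycles, the walk
  ends at some \<open>k\<close> with \<open>u k = 0\<close>, and \<open>(v, k)\<close> is an arrow by transitivity. Then \<open>b k = 0\<close>, which
  forces \<open>b v = 1\<close>.
\<close>
lemma minimal_cover_above_refinement:
  fixes E :: "('v::finite \<times> 'v) set"
  assumes E: "trans E" "irrefl E"
    and u: "edge_cover E d u"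
    and minimal: "\<And>w. edge_cover E d w \<Longrightarrow> (\<forall>v. w v \<le> u v) \<Longrightarrow> w = u"
    and b: "edge_containing E d b" "refines b (\<lambda>v. if u v \<ge> 1 then 1 else 0)"
  shows "b v \<le> u v"
proof -
  have weak_successor: "\<exists>j. (v, j) \<in> E \<and> u j < d j" if v: "u v \<ge> 1" "u v < d v" for v
  proof (rule ccontr)
    assume strong: "\<not> ?thesis"
    \<comment> \<open>If all heads of arrows from \<open>v\<close> are heavy enough, then dropping \<open>v\<close> leaves a smaller cover;
      arrows into \<open>v\<close> do not rely on \<open>u v\<close>, which is below \<open>d v\<close>.\<close>
    let ?w = "u(v := 0)"
    have "edge_cover E d ?w"
      unfolding edge_cover_def
    proof clarify
      fix i j assume ij: "(i, j) \<in> E" "\<not> d j \<le> ?w j"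
      have "i \<noteq> j"
        using E(2) ij(1) by (auto simp: irrefl_def)
      have uj: "\<not> d j \<le> u j"
        using ij(2) v by (auto split: if_splits)
      then have "i \<noteq> v"
        using strong ij(1) by auto
      then show "1 \<le> ?w i"
        using u ij(1) uj by (auto simp: edge_cover_def)
    qed
    then have "?w = u"
      by (rule minimal) simp
    then show False
      using v(1) by (metis fun_upd_same not_one_le_zero)
  qed
  have "acyclic E"
    using E by (simp add: acyclic_irrefl)
  then have "wf (E\<inverse>)"
    by (intro finite_acyclic_wf_converse) simp
  then have uncovered_successor: "\<exists>k. (v, k) \<in> E \<and> u k = 0" if "u v \<ge> 1" "u v < d v" for v
    using that
  proof (induction v rule: wf_induct_rule)
    case (less v)
    then obtain j where j: "(v, j) \<in> E" "u j < d j"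
      using weak_successor by blast
    show ?case
    proof (cases "u j = 0")
      case False
      then obtain k where "(j, k) \<in> E" "u k = 0"
        using less.IH[of j] j by auto
      then show ?thesis
        using transD[OF E(1) j(1)] by blast
    qed (use j in blast)
  qed
  show ?thesis
  proof (cases "b v \<ge> 1 \<and> u v < d v")
    case True
    then have "u v \<ge> 1"
      using b(2) by (auto simp: refines_def split: if_splits)
    then obtain k where k: "(v, k) \<in> E" "u k = 0"
      using uncovered_successor True by blast
    then have "b k = 0"
      using b(2) unfolding refines_def by (metis less_one not_less)
    then have "b v = 1"
      using b(1) k(1) by (auto simp: edge_containing_def)
    then show ?thesis
      using \<open>u v \<ge> 1\<close> by simp
  next
    case False
    moreover have "u v \<ge> 1" if "b v \<ge> 1"
      using b(2) that by (auto simp: refines_def split: if_splits)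
    moreover have "b v \<in> {0, 1, d v}"
      using b(1) by (simp add: edge_containing_def)
    ultimately show ?thesis
      by (cases "b v = 0") (auto simp: not_less)
  qed
qed

section \<open>The edge ideal, its dual and its components\<close>

definition edge_exponent :: "('v \<Rightarrow> nat) \<Rightarrow> 'v \<times> 'v \<Rightarrow> ('v \<Rightarrow>\<^sub>0 nat)"
  where "edge_exponent d e = single (fst e) 1 + single (snd e) (d (snd e))"

lemma lookup_edge_exponent:
  "i \<noteq> j \<Longrightarrow> lookup (edge_exponent d (i, j)) v = (if v = i then 1 else if v = j then d j else 0)"
  by (simp add: edge_exponent_def lookup_add lookup_single when_def)

lemma edge_ideal_eq_monom: "edge_ideal E d = ideal_gen (monom ` edge_exponent d ` E)"
proof -
  have "Var i * Var j ^ d j = monom (edge_exponent d (i, j))" for i j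
    unfolding Var_power unfolding Var_def monom_mult by (simp add: edge_exponent_def)
  then have "{Var i * Var j ^ d j | i j. (i, j) \<in> E} = monom ` edge_exponent d ` E"
    by force
  then show ?thesis
    unfolding edge_ideal_def by (rule arg_cong)
qed

lemma mem_edge_ideal_iff:
  assumes "irrefl E"
  shows "f \<in> edge_ideal E d \<longleftrightarrow> (\<forall>t\<in>keys f. \<exists>(i, j)\<in>E. lookup t i \<ge> 1 \<and> lookup t j \<ge> d j)"
proof -
  have "edge_exponent d (i, j) \<preceq> t \<longleftrightarrow> lookup t i \<ge> 1 \<and> lookup t j \<ge> d j" if "(i, j) \<in> E" for i j t
  proof -
    have "i \<noteq> j"
      using assms that by (auto simp: irrefl_def)
    then show ?thesis
      by (auto simp: exp_le_def lookup_edge_exponent)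
  qed
  then show ?thesis
    unfolding edge_ideal_eq_monom mem_ideal_gen_monom_iff by fastforce
qed

text \<open>
  Two generators could divide each other only if their arrows join the same two vertices; asymmetry
  then makes the arrows equal.
\<close>
lemma min_gens_edge_ideal:
  assumes "asym E" and d: "\<And>v. d v \<ge> 1"
  shows "min_gens (edge_ideal E d) = monom ` edge_exponent d ` E"
  unfolding edge_ideal_eq_monom
proof (rule min_gens_antichain, clarify)
  fix i j k l
  assume ij: "(i, j) \<in> E" and kl: "(k, l) \<in> E"
    and le: "edge_exponent d (i, j) \<preceq> edge_exponent d (k, l)"
  have neq: "i \<noteq> j" "k \<noteq> l"
    using asymD[OF assms(1)] ij kl by blast+
  have "lookup (edge_exponent d (k, l)) v \<ge> 1" if "v = i \<or> v = j" for v
  proof -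
    have "lookup (edge_exponent d (i, j)) v \<ge> 1"
      using neq(1) d[of j] that by (auto simp: lookup_edge_exponent)
    then show ?thesis
      using le unfolding exp_le_def by (meson le_trans)
  qed
  then have "i \<in> {k, l}" "j \<in> {k, l}"
    using neq(2) by (force simp: lookup_edge_exponent split: if_splits)+
  then have "(i, j) = (k, l)"
    using neq(1) ij kl asymD[OF assms(1)] by auto
  then show "edge_exponent d (i, j) = edge_exponent d (k, l)"
    by simp
qed

lemma mem_dual_edge_ideal_iff:
  fixes f :: "('v, 'k::comm_ring_1) mpoly"
  assumes "asym E" and d: "\<And>v. d v \<ge> 1"
  shows "f \<in> dual_ideal (edge_ideal E d) \<longleftrightarrow> (\<forall>t\<in>keys f. edge_cover E d (lookup t))"
proof -
  have "{a. (monom a :: ('v, 'k) mpoly) \<in> min_gens (edge_ideal E d)} = edge_exponent d ` E"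
    unfolding min_gens_edge_ideal[OF assms] by (simp add: inj_image_mem_iff[OF inj_monom])
  then have "dual_ideal (edge_ideal E d :: ('v, 'k) mpoly set) = (\<Inter>e\<in>E. pure_power_ideal (edge_exponent d e))"
    unfolding dual_ideal_def pure_power_ideal_def by simp
  moreover have "(\<exists>v. 1 \<le> lookup (edge_exponent d (i, j)) v \<and> lookup (edge_exponent d (i, j)) v \<le> lookup t v)
      \<longleftrightarrow> lookup t i \<ge> 1 \<or> lookup t j \<ge> d j" if "(i, j) \<in> E" for i j t
  proof -
    have "i \<noteq> j"
      using asymD[OF assms(1)] that by blast
    then show ?thesis
      using d[of j] by (auto simp: lookup_edge_exponent)
  qed
  ultimately show ?thesis
    unfolding edge_cover_def by (simp add: mem_pure_power_ideal_iff split_beta) (metis prod.collapse)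
qed

text \<open>
  A monomial \<open>t\<close> outside the edge ideal is excluded by one of the ideals: take each variable to the
  least of the exponents \<open>1\<close>, \<open>d v\<close> above its exponent in \<open>t\<close>, and leave it out if there is none.
\<close>
lemma edge_ideal_eq_Inter:
  fixes E :: "('v::finite \<times> 'v) set"
  assumes "irrefl E" and d: "\<And>v. d v \<ge> 1"
  shows "(edge_ideal E d :: ('v, 'k::comm_ring_1) mpoly set)
    = \<Inter>(pure_power_ideal ` {c. edge_containing E d (lookup c)})"
proof (intro equalityI subsetI)
  fix f :: "('v, 'k) mpoly"
  assume f: "f \<in> edge_ideal E d"
  show "f \<in> \<Inter>(pure_power_ideal ` {c. edge_containing E d (lookup c)})"
  proof clarify
    fix c :: "'v \<Rightarrow>\<^sub>0 nat" assume c: "edge_containing E d (lookup c)"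
    show "f \<in> pure_power_ideal c"
      unfolding mem_pure_power_ideal_iff
    proof
      fix t assume "t \<in> keys f"
      then obtain i j where t: "(i, j) \<in> E" "lookup t i \<ge> 1" "lookup t j \<ge> d j"
        using f unfolding mem_edge_ideal_iff[OF assms(1)] by blast
      show "\<exists>v. 1 \<le> lookup c v \<and> lookup c v \<le> lookup t v"
      proof (cases "lookup c i = 1")
        case True
        then show ?thesis
          using t by (intro exI[of _ i]) simp
      next
        case False
        then have "lookup c j \<ge> 1"
          using c t(1) by (auto simp: edge_containing_def)
        moreover have "lookup c j \<in> {0, 1, d j}"
          using c by (simp add: edge_containing_def)
        ultimately show ?thesis
          using t(3) d[of j] by (intro exI[of _ j]) auto
      qed
    qed
  qed
next
  fix f :: "('v, 'k) mpoly"
  assume f: "f \<in> \<Inter>(pure_power_ideal ` {c. edge_containing E d (lookup c)})"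
  show "f \<in> edge_ideal E d"
    unfolding mem_edge_ideal_iff[OF assms(1)]
  proof (intro ballI, rule ccontr)
    fix t assume t: "t \<in> keys f" "\<not> (\<exists>(i, j)\<in>E. lookup t i \<ge> 1 \<and> lookup t j \<ge> d j)"
    define c where "c = Abs_poly_mapping (\<lambda>v. if lookup t v = 0 then 1 else if lookup t v < d v then d v else 0)"
    have c: "lookup c v = (if lookup t v = 0 then 1 else if lookup t v < d v then d v else 0)" for v
      by (simp add: c_def)
    have "lookup c i = 1 \<or> 1 \<le> lookup c j" if "(i, j) \<in> E" for i j
    proof -
      have "\<not> (lookup t i \<ge> 1 \<and> lookup t j \<ge> d j)"
        using t(2) that by blast
      then show ?thesis
        using d[of j] by (auto simp: c Suc_le_eq)
    qed
    then have "\<forall>(i, j)\<in>E. lookup c i = 1 \<or> 1 \<le> lookup c j"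
      by blast
    moreover have "\<forall>v. lookup c v \<in> {0, 1, d v}"
      by (simp add: c)
    ultimately have "edge_containing E d (lookup c)"
      unfolding edge_containing_def by blast
    then have "f \<in> pure_power_ideal c"
      using f by blast
    then obtain v where "1 \<le> lookup c v" "lookup c v \<le> lookup t v"
      using t(1) unfolding mem_pure_power_ideal_iff by blast
    then show False
      by (auto simp: c split: if_splits)
  qed
qed

lemma finite_edge_containing:
  fixes E :: "('v::finite \<times> 'v) set"
  shows "finite {c. edge_containing E d (lookup c)}"
proof (rule inj_on_finite)
  show "inj_on lookup {c. edge_containing E d (lookup c)}"
    by (intro inj_onI poly_mapping_eqI) simp
  show "lookup ` {c. edge_containing E d (lookup c)} \<subseteq> (\<Pi>\<^sub>E v\<in>UNIV. {0, 1, d v})"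
    by (rule image_subsetI, rule PiE_I) (simp_all add: edge_containing_def)
  show "finite (\<Pi>\<^sub>E v\<in>UNIV. {0, 1, d v})"
    by (rule finite_PiE) auto
qed

theorem theorem4:
  fixes E :: "('v::finite \<times> 'v) set" and d :: "'v \<Rightarrow> nat"
    and I :: "('v, 'k::field) mpoly set"
  assumes "weighted_oriented_graph E d"
    and "transitive_graph E"
    and "I = edge_ideal E d"
  shows "dual_ideal I = alexander_dual I"
proof -
  have asym: "asym E" and d: "\<And>v. d v \<ge> 1"
    using assms(1) by (auto simp: weighted_oriented_graph_def)
  have irrefl: "irrefl E"
    using asymD[OF asym] by (auto simp: irrefl_def)
  have trans: "trans E"
  proof (rule transI)
    fix i j k assume "(i, j) \<in> E" "(j, k) \<in> E"
    then show "(i, k) \<in> E"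
      using assms(2) asymD[OF asym] unfolding transitive_graph_def by metis
  qed
  \<comment> \<open>By the choice of \<open>N\<close>, the irreducible components are the ideals given by the members of \<open>N\<close>.\<close>
  define X where "X = {c. edge_containing E d (lookup c)}"
  define N where "N = {c \<in> X. \<forall>b\<in>X. refines (lookup b) (lookup c) \<longrightarrow> b = c}"
  let ?F = "pure_power_ideal ` X :: ('v, 'k) mpoly set set"
  have subset_iff: "(pure_power_ideal b :: ('v, 'k) mpoly set) \<subseteq> pure_power_ideal c
      \<longleftrightarrow> refines (lookup b) (lookup c)" for b c
    unfolding pure_power_ideal_subset_iff refines_def ..
  have eq_iff: "(pure_power_ideal b :: ('v, 'k) mpoly set) = pure_power_ideal c \<longleftrightarrow> b = c" for b c
    using pure_power_ideal_inject by blast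
  have "finite ?F"
    unfolding X_def by (intro finite_imageI finite_edge_containing)
  then have "irreducible_components (\<Inter>?F) = {J \<in> ?F. \<forall>J'\<in>?F. J' \<subseteq> J \<longrightarrow> J' = J}"
    by (rule irreducible_components_Inter) blast
  also have "\<dots> = pure_power_ideal ` N"
    unfolding N_def by (auto simp: subset_iff eq_iff)
  also have "\<Inter>?F = I"
    unfolding assms(3) X_def by (rule edge_ideal_eq_Inter[symmetric, OF irrefl d])
  finally have components: "irreducible_components I = pure_power_ideal ` N" .
  have "{\<Prod>f\<in>min_gens J. f | J. J \<in> irreducible_components I}
      = (\<lambda>c. \<Prod>f\<in>min_gens (pure_power_ideal c). f) ` N"
    unfolding components by blast
  also have "\<dots> = monom ` N"
    by (simp only: prod_min_gens_pure_power_ideal)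
  finally have dual: "alexander_dual I = ideal_gen (monom ` N)"
    unfolding alexander_dual_def by (rule arg_cong)
  have "edge_cover E d (lookup t) \<longleftrightarrow> (\<exists>c\<in>N. c \<preceq> t)" for t
  proof
    assume "\<exists>c\<in>N. c \<preceq> t"
    then obtain c where c: "c \<in> N" "c \<preceq> t" by blast
    have "edge_cover E d (lookup c)"
    proof (rule maximal_edge_containing_is_cover[OF trans d])
      show "edge_containing E d (lookup c)"
        using c by (simp add: N_def X_def)
      fix b assume b: "edge_containing E d b" "refines b (lookup c)"
      have "lookup (Abs_poly_mapping b) = b"
        by simp
      then show "b = lookup c"
        using c(1) b unfolding N_def X_def by (metis (mono_tags, lifting) mem_Collect_eq)
    qed
    then show "edge_cover E d (lookup t)"
      by (rule edge_cover_mono) (use c(2) in \<open>simp add: exp_le_def\<close>)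
  next
    assume "edge_cover E d (lookup t)"
    then obtain u where u: "edge_cover E d (lookup u)" "u \<preceq> t"
        "\<forall>w. edge_cover E d (lookup w) \<longrightarrow> w \<preceq> u \<longrightarrow> w = u"
      by (rule exists_minimal_exponent[where P = "\<lambda>u. edge_cover E d (lookup u)"]) (rule that)
    \<comment> \<open>The ideal generated by the variables in the support of the minimal cover \<open>u\<close>; a component inside
      it has a product of generators that divides \<open>u\<close>.\<close>
    define s where "s = Abs_poly_mapping (\<lambda>v. if lookup u v \<ge> 1 then 1 else 0 :: nat)"
    have s: "lookup s = (\<lambda>v. if lookup u v \<ge> 1 then 1 else 0)"
      by (simp add: s_def)
    have "s \<in> X"
      unfolding X_def using edge_containing_support_of_cover[OF d u(1)] by (simp add: s)
    then have "pure_power_ideal s \<in> ?F" by blast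
    from finite_has_minimal2[OF \<open>finite ?F\<close> this]
    obtain b where b: "b \<in> X" "refines (lookup b) (lookup s)"
        "\<forall>c\<in>X. refines (lookup c) (lookup b) \<longrightarrow> c = b"
      by (auto simp: subset_iff eq_iff)
    have "lookup b v \<le> lookup u v" for v
    proof (rule minimal_cover_above_refinement[OF trans irrefl u(1)])
      fix w assume w: "edge_cover E d w" "\<forall>v. w v \<le> lookup u v"
      have "lookup (Abs_poly_mapping w) = w"
        by simp
      then show "w = lookup u"
        using u(3) w unfolding exp_le_def by metis
    qed (use b in \<open>simp_all add: X_def s\<close>)
    then have "b \<preceq> t"
      using u(2) exp_le_trans[of b u t] by (simp add: exp_le_def)
    then show "\<exists>c\<in>N. c \<preceq> t"
      using b by (auto simp: N_def)
  qed
  then have "dual_ideal I = ideal_gen (monom ` N)"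
    unfolding assms(3) by (simp add: set_eq_iff mem_dual_edge_ideal_iff[OF asym d] mem_ideal_gen_monom_iff)
  then show ?thesis
    by (simp only: dual)
qed

end
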